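(* Let $G$ be a permutation graph with a fixed permutation representation $(<_1,<_2)$. Then the orientation $\triangleleft$ of the compatibility graph $H_G$ determined by this representation is transitive: for all vertices $e,f,g$ of $H_G$, if $e\triangleleft f$ and $f\triangleleft g$, then $eg$ is an edge of $H_G$ and $e\triangleleft g$.
   Context: All graphs are finite, simple and undirected. A permutation representation of $G$ is a pair of linear orders $<_1,<_2$ on $V(G)$ such that two vertices are adjacent in $G$ precisely when they occur in opposite orders in $<_1$ and $<_2$; $G$ is a permutation graph if it has one. Define the strict partial order $\prec$ on $V(G)$ by $u\prec v$ if and only if $u<_1 v$ and $u<_2 v$. Thus distinct vertices are nonadjacent in $G$ exactly when they are comparable under $\prec$. The compatibility graph $H_G$ has as vertices the ordered edges $(c,\ell)$ with $c\ell\in E(G)$ (each edge gives two ordered edges). Two distinct ordered edges $(c,\ell)$ and $(d,r)$ are adjacent in $H_G$ if and only if they are compatible, i.e. either (same centre) $c=d$, $\ell\ne r$ and $\ell r\notin E(G)$; or (different centres) $c\neq d$, the four vertices $c,\ell,d,r$ are distinct, and $cd,cr,\ell d,\ell r\notin E(G)$. Each edge of $H_G$ is given exactly one direction by $\triangleleft$ as follows. For adjacent $(c,\ell)$ and $(c,r)$ with the same centre: $(c,\ell)\triangleleft(c,r)$ if $\ell\prec r$, and $(c,r)\triangleleft(c,\ell)$ if $r\prec\ell$. For adjacent $(c,\ell)$ and $(d,r)$ with $c\ne d$: one of the pairs $\{c,\ell\}$, $\{d,r\}$ is completely before the other under $\prec$; $(c,\ell)\triangleleft(d,r)$ if $c\prec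 d$, $c\prec r$, $\ell\prec d$ and $\ell\prec r$, and otherwise (when $d\prec c$, $d\prec\ell$, $r\prec c$, $r\prec\ell$) $(d,r)\triangleleft(c,\ell)$. *)

theory Defs
  imports "Graph_Theory.Pair_Digraph"
begin

text \<open>
  A finite simple undirected graph is a \<open>pair_graph\<close>: a finite, loop-free, symmetric arc relation
  without parallel arcs. Both orientations of an edge belong to \<open>parcs G\<close>, so \<open>parcs G\<close> is at the
  same time the adjacency relation and the set of ordered edges of \<open>G\<close>.
\<close>

definition permutation_representation ::
  "'a pair_pre_digraph \<Rightarrow> 'a rel \<Rightarrow> 'a rel \<Rightarrow> bool" where
  "permutation_representation G lt1 lt2 \<longleftrightarrow>
     lt1 \<subseteq> pverts G \<times> pverts G \<and> strict_linear_order_on (pverts G) lt1 \<and>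
     lt2 \<subseteq> pverts G \<times> pverts G \<and> strict_linear_order_on (pverts G) lt2 \<and>
     (\<forall>u \<in> pverts G. \<forall>v \<in> pverts G. u \<noteq> v \<longrightarrow>
        ((u, v) \<in> parcs G \<longleftrightarrow>
           (u, v) \<in> lt1 \<and> (v, u) \<in> lt2 \<or> (v, u) \<in> lt1 \<and> (u, v) \<in> lt2))"

definition prec :: "'a rel \<Rightarrow> 'a rel \<Rightarrow> 'a \<Rightarrow> 'a \<Rightarrow> bool" where
  "prec lt1 lt2 u v \<longleftrightarrow> (u, v) \<in> lt1 \<and> (u, v) \<in> lt2"

text \<open>An ordered edge \<open>(c, l)\<close> has centre \<open>c\<close>.\<close>

definition compatible :: "'a pair_pre_digraph \<Rightarrow> 'a \<times> 'a \<Rightarrow> 'a \<times> 'a \<Rightarrow> bool" where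
  "compatible G = (\<lambda>(c, l) (d, r).
     (c = d \<and> l \<noteq> r \<and> (l, r) \<notin> parcs G) \<or>
     (c \<noteq> d \<and> distinct [c, l, d, r] \<and>
      (c, d) \<notin> parcs G \<and> (c, r) \<notin> parcs G \<and> (l, d) \<notin> parcs G \<and> (l, r) \<notin> parcs G))"

definition compat_graph :: "'a pair_pre_digraph \<Rightarrow> ('a \<times> 'a) pair_pre_digraph" where
  "compat_graph G =
     \<lparr> pverts = parcs G,
       parcs = {(e, f). e \<in> parcs G \<and> f \<in> parcs G \<and> e \<noteq> f \<and> compatible G e f} \<rparr>"

text \<open>
  The relation below only relates adjacent ordered edges. Reversing a pair of adjacent ordered
  edges swaps the roles of \<open>(c, l)\<close> and \<open>(d, r)\<close>, which gives the second alternative in each of the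
  two cases; \<open>oriented_compat_exactly_one\<close> confirms that every edge of the compatibility graph gets
  exactly one direction.
\<close>

definition oriented_compat ::
  "'a pair_pre_digraph \<Rightarrow> 'a rel \<Rightarrow> 'a rel \<Rightarrow> 'a \<times> 'a \<Rightarrow> 'a \<times> 'a \<Rightarrow> bool" where
  "oriented_compat G lt1 lt2 = (\<lambda>(c, l) (d, r).
     ((c, l), (d, r)) \<in> parcs (compat_graph G) \<and>
     ((c = d \<and> prec lt1 lt2 l r) \<or>
      (c \<noteq> d \<and> prec lt1 lt2 c d \<and> prec lt1 lt2 c r \<and> prec lt1 lt2 l d \<and> prec lt1 lt2 l r)))"

lemma pair_graph_compat_graph:
  assumes "pair_graph G"
  shows "pair_graph (compat_graph G)"
proof -
  interpret pair_graph G by fact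
  have sym: "(v, u) \<in> parcs G" if "(u, v) \<in> parcs G" for u v
    using pair_sym_arcs that by (auto simp: symmetric_def dest: symD)
  have "finite (parcs (compat_graph G))"
    by (rule finite_subset[of _ "parcs G \<times> parcs G"])
      (auto simp: compat_graph_def pair_finite_arcs)
  then show ?thesis
    by unfold_locales
      (auto simp: compat_graph_def compatible_def symmetric_def pair_finite_arcs
        intro!: symI dest: sym)
qed

lemma not_adjacent_prec:
  assumes "permutation_representation G lt1 lt2"
    and "u \<in> pverts G" "v \<in> pverts G" "u \<noteq> v" "(u, v) \<notin> parcs G"
  shows "prec lt1 lt2 u v \<or> prec lt1 lt2 v u"
  using assms
  unfolding permutation_representation_def strict_linear_order_on_def total_on_def prec_def
  by blast

lemma prec_not_adjacent:
  assumes rep: "permutation_representation G lt1 lt2" and uv: "prec lt1 lt2 u v"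
  shows "(u, v) \<notin> parcs G" "(v, u) \<notin> parcs G" "\<not> prec lt1 lt2 v u"
proof -
  have V: "u \<in> pverts G" "v \<in> pverts G" and lt: "(u, v) \<in> lt1" "(u, v) \<in> lt2"
    using rep uv by (auto simp: permutation_representation_def prec_def)
  have tr: "trans lt1" "trans lt2" and irr: "irrefl lt1" "irrefl lt2"
    using rep by (auto simp: permutation_representation_def strict_linear_order_on_def)
  have not: "(v, u) \<notin> lt1" "(v, u) \<notin> lt2"
    using tr irr lt by (meson irreflD transD)+
  have "u \<noteq> v"
    using lt not by auto
  then show "(u, v) \<notin> parcs G" "(v, u) \<notin> parcs G" "\<not> prec lt1 lt2 v u"
    using rep V not by (auto simp: permutation_representation_def prec_def)
qed

lemma prec_trans:
  assumes "permutation_representation G lt1 lt2" "prec lt1 lt2 u v" "prec lt1 lt2 v w"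
  shows "prec lt1 lt2 u w"
  using assms
  unfolding permutation_representation_def strict_linear_order_on_def prec_def trans_def
  by blast

lemma oriented_compat_exactly_one:
  assumes "pair_graph G" and rep: "permutation_representation G lt1 lt2"
    and adj: "(e, f) \<in> parcs (compat_graph G)"
  shows "oriented_compat G lt1 lt2 e f \<longleftrightarrow> \<not> oriented_compat G lt1 lt2 f e"
proof -
  interpret H: pair_graph "compat_graph G"
    using assms(1) by (rule pair_graph_compat_graph)
  interpret pair_graph G by fact
  obtain c l d r where ef: "e = (c, l)" "f = (d, r)"
    by (metis surj_pair)
  have adj': "(f, e) \<in> parcs (compat_graph G)"
    using H.pair_sym_arcs adj by (auto simp: symmetric_def dest: symD)
  have cl: "(c, l) \<in> parcs G" "(d, r) \<in> parcs G" and comp: "compatible G (c, l) (d, r)"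
    using adj by (auto simp: compat_graph_def ef)
  have V: "c \<in> pverts G" "l \<in> pverts G" "d \<in> pverts G" "r \<in> pverts G"
    using cl by (auto dest: wellformed')
  note comparable = not_adjacent_prec[OF rep]
  note tr = prec_trans[OF rep]
  note na = prec_not_adjacent[OF rep]
  show ?thesis
  proof (cases "c = d")
    case True
    then show ?thesis
      using comp comparable[of l r] V na(3)[of l r] na(3)[of r l] adj adj'
      by (auto simp: oriented_compat_def ef compatible_def)
  next
    case False
    then have ne: "distinct [c, l, d, r]" "(c, d) \<notin> parcs G" "(c, r) \<notin> parcs G"
      "(l, d) \<notin> parcs G" "(l, r) \<notin> parcs G"
      using comp by (auto simp: compatible_def)
    have cmp: "prec lt1 lt2 c d \<or> prec lt1 lt2 d c" "prec lt1 lt2 c r \<or> prec lt1 lt2 r c"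
      "prec lt1 lt2 l d \<or> prec lt1 lt2 d l" "prec lt1 lt2 l r \<or> prec lt1 lt2 r l"
      using comparable[of c d] comparable[of c r] comparable[of l d] comparable[of l r] V ne
      by auto
    have no: "\<not> prec lt1 lt2 c l" "\<not> prec lt1 lt2 l c" "\<not> prec lt1 lt2 d r" "\<not> prec lt1 lt2 r d"
      using cl na(1,2) by blast+
    have "prec lt1 lt2 c d \<and> prec lt1 lt2 c r \<and> prec lt1 lt2 l d \<and> prec lt1 lt2 l r \<longleftrightarrow>
      \<not> (prec lt1 lt2 d c \<and> prec lt1 lt2 d l \<and> prec lt1 lt2 r c \<and> prec lt1 lt2 r l)"
      using cmp no tr na(3) by meson
    then show ?thesis
      using False adj adj' by (auto simp: oriented_compat_def ef)
  qed
qed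

end

theory Submission
  imports Defs
begin

text \<open>Comparable vertices are distinct and nonadjacent, so compatibility is implied by the order
  conditions alone; transitivity of \<open>oriented_compat\<close> then reduces to that of \<open>prec\<close>.\<close>

lemma oriented_compat_iff:
  assumes "pair_graph G" and rep: "permutation_representation G lt1 lt2"
  shows "oriented_compat G lt1 lt2 (c, l) (d, r) \<longleftrightarrow>
    (c, l) \<in> parcs G \<and> (d, r) \<in> parcs G \<and>
    (c = d \<and> prec lt1 lt2 l r \<or>
     c \<noteq> d \<and> prec lt1 lt2 c d \<and> prec lt1 lt2 c r \<and> prec lt1 lt2 l d \<and> prec lt1 lt2 l r)"
proof -
  interpret pair_graph G by fact
  have loopfree: "u \<noteq> v" if "(u, v) \<in> parcs G" for u v
    using that pair_no_loops by fastforce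
  have prec_neq: "u \<noteq> v" if "prec lt1 lt2 u v" for u v
    using prec_not_adjacent(3)[OF rep that] that by auto
  \<comment> \<open>With different centres, the four \<open>prec\<close> relations give the
    nonadjacencies and cross inequalities; loop-freeness supplies \<open>c \<noteq> l\<close> and
    \<open>d \<noteq> r\<close>. With a common centre, \<open>prec lt1 lt2 l r\<close> alone
    suffices.\<close>
  show ?thesis
    using loopfree prec_neq prec_not_adjacent(1)[OF rep]
    by (auto simp: oriented_compat_def compat_graph_def compatible_def)
qed

theorem lemma4:
  fixes G :: "'a pair_pre_digraph" and lt1 lt2 :: "'a rel"
  assumes "pair_graph G"
    and "permutation_representation G lt1 lt2"
  shows "\<forall>e \<in> pverts (compat_graph G). \<forall>f \<in> pverts (compat_graph G). \<forall>g \<in> pverts (compat_graph G).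
           oriented_compat G lt1 lt2 e f \<and> oriented_compat G lt1 lt2 f g \<longrightarrow>
           (e, g) \<in> parcs (compat_graph G) \<and> oriented_compat G lt1 lt2 e g"
proof (intro ballI impI)
  fix e f g
  assume efg: "oriented_compat G lt1 lt2 e f \<and> oriented_compat G lt1 lt2 f g"
  obtain c l d r x y where eqs: "e = (c, l)" "f = (d, r)" "g = (x, y)"
    by (metis surj_pair)
  note iff = oriented_compat_iff[OF assms]
  note trans = prec_trans[OF assms(2)]
  have irrefl: "\<not> prec lt1 lt2 u u" for u
    using prec_not_adjacent(3)[OF assms(2)] by blast
  \<comment> \<open>Split on \<open>c = d\<close> and \<open>d = x\<close>. If both centres change,
    every relation passes through \<open>d\<close>, and \<open>c\<close> precedes \<open>x\<close>,
    so irreflexivity excludes \<open>c = x\<close>. If only one changes, the relations not inherited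
    through the shared centre pass through \<open>r\<close>.\<close>
  have "oriented_compat G lt1 lt2 e g"
    using efg irrefl trans unfolding eqs iff by metis
  moreover from this have "(e, g) \<in> parcs (compat_graph G)"
    by (auto simp: oriented_compat_def eqs)
  ultimately show "(e, g) \<in> parcs (compat_graph G) \<and> oriented_compat G lt1 lt2 e g"
    by blast
qed

end
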